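(* Let $p$ be a program of the while-language $\mathcal{W}$. Then the axiomatic semantics $[\![ p ]\!]$ of $p$ in trace logic is sound with respect to the standard small-step operational semantics of $\mathcal{W}$, i.e. every execution interpretation of $p$ is a model of $[\![ p ]\!]$.
   Context: $\mathcal{W}$ is an imperative while-language with a single main function, integer variables and integer arrays (mutable or constant), assignments, array assignments, skip, if-then-else and while statements. Trace logic is a many-sorted first-order logic with sorts $\mathbb{N}$ (loop iterations, term algebra with $\mathtt{0},\mathtt{suc}$), $\mathbb{I}$ (integers), $\mathbb{L}$ (timepoints) and $\mathbb{B}$; program locations are functions $l_s$ of the iterations of the enclosing loops, $n_s$ (written $\mathit{lastIt}_s$) denotes the last iteration of a loop $s$, program variables are functions $v(tp)$ (and $v(tp,pos)$ for arrays) of timepoints, and $\mathit{Reach}(tp)$ is a predicate over timepoints. The axiomatic semantics $[\![ p ]\!]$ is the conjunction, over all statements $s$ of $p$, of $\forall \mathit{enclIts}.\,(\mathit{Reach}(\mathit{start}_s) \rightarrow [\![ s ]\!])$, where $[\![ s ]\!]$ is the trace-logic axiom of statement $s$ (e.g. for an assignment $v=e$, $v(\mathit{end}_s) \simeq$ value of $e$ at $\mathit{start}_s$ and all other variables unchanged; for a loop, $\mathit{lastIt}_s$ is the first iteration where the loop condition fails, entering the body changes no variables, and values at $\mathit{end}_s$ equal those at the loop head in iteration $\mathit{lastIt}_s$). An execution interpretation is a first-order interpretation induced by a run of the small-step operational semantics: $\mathit{Reach}$ holds exactly at the reached timepoints, variable symbols are interpreted according to the transition rules at reached timepoints, and theory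 symbols according to the background theory.
   Formalization: An execution interpretation is required to interpret lastIt of each reached loop instance as its last reached iteration, so non-terminating runs induce none; for such runs (e.g. while(true){skip}) the loop axiom is false. *)

theory Defs
  imports Main
begin

section \<open>The while-language\<close>

type_synonym vname = string
type_synonym label = nat

datatype aexp =
    Num int
  | IntVar vname
  | ArrAt vname aexp
  | CIntVar vname
  | CArrAt vname aexp
  | Add aexp aexp
  | Sub aexp aexp
  | Mul aexp aexp

datatype bexp =
    BTrue
  | BEq aexp aexp
  | BLess aexp aexp
  | BNot bexp
  | BAnd bexp bexp
  | BOr bexp bexp

text \<open>Statements carry a label, which names their program location. A context
  is a nonempty sequence of statements.\<close>

datatype stmt =
    Skip label
  | Assign label vname aexp
  | ArrAssign label vname aexp aexp
  | Ite label bexp ctx ctx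
  | While label bexp ctx
and ctx =
    Single stmt
  | Seq stmt ctx

record program =
  int_vars :: "vname list"
  arr_vars :: "vname list"
  const_ints :: "vname list"
  const_arrs :: "vname list"
  main :: ctx

primrec label_of :: "stmt \<Rightarrow> label" where
  "label_of (Skip l) = l"
| "label_of (Assign l x e) = l"
| "label_of (ArrAssign l x e1 e2) = l"
| "label_of (Ite l b c1 c2) = l"
| "label_of (While l b c) = l"

primrec is_while :: "stmt \<Rightarrow> bool" where
  "is_while (Skip l) = False"
| "is_while (Assign l x e) = False"
| "is_while (ArrAssign l x e1 e2) = False"
| "is_while (Ite l b c1 c2) = False"
| "is_while (While l b c) = True"

primrec first_stmt :: "ctx \<Rightarrow> stmt" where
  "first_stmt (Single s) = s"
| "first_stmt (Seq s c) = s"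

primrec stmts :: "ctx \<Rightarrow> stmt list" where
  "stmts (Single s) = [s]"
| "stmts (Seq s c) = s # stmts c"

primrec labels_stmt :: "stmt \<Rightarrow> label list" and labels_ctx :: "ctx \<Rightarrow> label list" where
  "labels_stmt (Skip l) = [l]"
| "labels_stmt (Assign l x e) = [l]"
| "labels_stmt (ArrAssign l x e1 e2) = [l]"
| "labels_stmt (Ite l b c1 c2) = l # labels_ctx c1 @ labels_ctx c2"
| "labels_stmt (While l b c) = l # labels_ctx c"
| "labels_ctx (Single s) = labels_stmt s"
| "labels_ctx (Seq s c) = labels_stmt s @ labels_ctx c"

primrec decl_aexp :: "program \<Rightarrow> aexp \<Rightarrow> bool" where
  "decl_aexp p (Num n) = True"
| "decl_aexp p (IntVar x) = (x \<in> set (int_vars p))"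
| "decl_aexp p (ArrAt x e) = (x \<in> set (arr_vars p) \<and> decl_aexp p e)"
| "decl_aexp p (CIntVar x) = (x \<in> set (const_ints p))"
| "decl_aexp p (CArrAt x e) = (x \<in> set (const_arrs p) \<and> decl_aexp p e)"
| "decl_aexp p (Add e1 e2) = (decl_aexp p e1 \<and> decl_aexp p e2)"
| "decl_aexp p (Sub e1 e2) = (decl_aexp p e1 \<and> decl_aexp p e2)"
| "decl_aexp p (Mul e1 e2) = (decl_aexp p e1 \<and> decl_aexp p e2)"

primrec decl_bexp :: "program \<Rightarrow> bexp \<Rightarrow> bool" where
  "decl_bexp p BTrue = True"
| "decl_bexp p (BEq e1 e2) = (decl_aexp p e1 \<and> decl_aexp p e2)"
| "decl_bexp p (BLess e1 e2) = (decl_aexp p e1 \<and> decl_aexp p e2)"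
| "decl_bexp p (BNot b) = decl_bexp p b"
| "decl_bexp p (BAnd b1 b2) = (decl_bexp p b1 \<and> decl_bexp p b2)"
| "decl_bexp p (BOr b1 b2) = (decl_bexp p b1 \<and> decl_bexp p b2)"

primrec decl_stmt :: "program \<Rightarrow> stmt \<Rightarrow> bool" and decl_ctx :: "program \<Rightarrow> ctx \<Rightarrow> bool" where
  "decl_stmt p (Skip l) = True"
| "decl_stmt p (Assign l x e) = (x \<in> set (int_vars p) \<and> decl_aexp p e)"
| "decl_stmt p (ArrAssign l x e1 e2) =
     (x \<in> set (arr_vars p) \<and> decl_aexp p e1 \<and> decl_aexp p e2)"
| "decl_stmt p (Ite l b c1 c2) = (decl_bexp p b \<and> decl_ctx p c1 \<and> decl_ctx p c2)"
| "decl_stmt p (While l b c) = (decl_bexp p b \<and> decl_ctx p c)"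
| "decl_ctx p (Single s) = decl_stmt p s"
| "decl_ctx p (Seq s c) = (decl_stmt p s \<and> decl_ctx p c)"

definition wf_program :: "program \<Rightarrow> bool" where
  "wf_program p \<longleftrightarrow> distinct (labels_ctx (main p)) \<and> decl_ctx p (main p)"


section \<open>Syntax of trace logic\<close>

text \<open>The location \<open>End\<close> is the end of the program.\<close>

datatype location = At label | End

text \<open>Terms of the sorts of iterations, timepoints and integers. The iteration variable
  of the loop labelled \<open>l\<close> is \<open>NVar l\<close>. Function symbols for locations and last
  iterations take the iterations of the enclosing loops, outermost first; a loop location
  takes in addition, as its last argument, the iteration of the loop itself.\<close>

datatype nterm =
    NVar nat
  | Zero
  | Succ nterm
  | LastIt label "nterm list"

datatype lterm =
    LVar nat
  | Loc location "nterm list"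

datatype iterm =
    IVar nat
  | IConst int
  | IAdd iterm iterm
  | ISub iterm iterm
  | IMul iterm iterm
  | PInt vname lterm
  | PArr vname lterm iterm
  | PCInt vname
  | PCArr vname iterm

datatype fm =
    FTrue
  | FEqN nterm nterm
  | FLessN nterm nterm
  | FEqI iterm iterm
  | FLessI iterm iterm
  | FEqL lterm lterm
  | FReach lterm
  | FNot fm
  | FAnd fm fm
  | FOr fm fm
  | FImp fm fm
  | FAllN nat fm
  | FAllI nat fm
  | FAllL nat fm

definition Conj :: "fm list \<Rightarrow> fm" where
  "Conj fs = foldr FAnd fs FTrue"


section \<open>Interpretations and satisfaction\<close>

text \<open>Iterations and integers are interpreted by their standard models, the sort of
  timepoints by an arbitrary domain.\<close>

record 'l interp =
  loc_of :: "location \<Rightarrow> nat list \<Rightarrow> 'l"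
  last_of :: "label \<Rightarrow> nat list \<Rightarrow> nat"
  int_of :: "vname \<Rightarrow> 'l \<Rightarrow> int"
  arr_of :: "vname \<Rightarrow> 'l \<Rightarrow> int \<Rightarrow> int"
  cint_of :: "vname \<Rightarrow> int"
  carr_of :: "vname \<Rightarrow> int \<Rightarrow> int"
  reach_of :: "'l \<Rightarrow> bool"

primrec nval :: "'l interp \<Rightarrow> (nat \<Rightarrow> nat) \<Rightarrow> nterm \<Rightarrow> nat" where
  "nval I vN (NVar x) = vN x"
| "nval I vN Zero = 0"
| "nval I vN (Succ t) = Suc (nval I vN t)"
| "nval I vN (LastIt l ts) = last_of I l (map (nval I vN) ts)"

primrec lval :: "'l interp \<Rightarrow> (nat \<Rightarrow> nat) \<Rightarrow> (nat \<Rightarrow> 'l) \<Rightarrow> lterm \<Rightarrow> 'l" where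
  "lval I vN vL (LVar x) = vL x"
| "lval I vN vL (Loc l ts) = loc_of I l (map (nval I vN) ts)"

primrec ival ::
  "'l interp \<Rightarrow> (nat \<Rightarrow> nat) \<Rightarrow> (nat \<Rightarrow> int) \<Rightarrow> (nat \<Rightarrow> 'l) \<Rightarrow> iterm \<Rightarrow> int" where
  "ival I vN vI vL (IVar x) = vI x"
| "ival I vN vI vL (IConst n) = n"
| "ival I vN vI vL (IAdd t1 t2) = ival I vN vI vL t1 + ival I vN vI vL t2"
| "ival I vN vI vL (ISub t1 t2) = ival I vN vI vL t1 - ival I vN vI vL t2"
| "ival I vN vI vL (IMul t1 t2) = ival I vN vI vL t1 * ival I vN vI vL t2"
| "ival I vN vI vL (PInt x tp) = int_of I x (lval I vN vL tp)"
| "ival I vN vI vL (PArr x tp t) = arr_of I x (lval I vN vL tp) (ival I vN vI vL t)"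
| "ival I vN vI vL (PCInt x) = cint_of I x"
| "ival I vN vI vL (PCArr x t) = carr_of I x (ival I vN vI vL t)"

primrec sat ::
  "'l interp \<Rightarrow> (nat \<Rightarrow> nat) \<Rightarrow> (nat \<Rightarrow> int) \<Rightarrow> (nat \<Rightarrow> 'l) \<Rightarrow> fm \<Rightarrow> bool" where
  "sat I vN vI vL FTrue \<longleftrightarrow> True"
| "sat I vN vI vL (FEqN t1 t2) \<longleftrightarrow> nval I vN t1 = nval I vN t2"
| "sat I vN vI vL (FLessN t1 t2) \<longleftrightarrow> nval I vN t1 < nval I vN t2"
| "sat I vN vI vL (FEqI t1 t2) \<longleftrightarrow> ival I vN vI vL t1 = ival I vN vI vL t2"
| "sat I vN vI vL (FLessI t1 t2) \<longleftrightarrow> ival I vN vI vL t1 < ival I vN vI vL t2"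
| "sat I vN vI vL (FEqL t1 t2) \<longleftrightarrow> lval I vN vL t1 = lval I vN vL t2"
| "sat I vN vI vL (FReach t) \<longleftrightarrow> reach_of I (lval I vN vL t)"
| "sat I vN vI vL (FNot f) \<longleftrightarrow> \<not> sat I vN vI vL f"
| "sat I vN vI vL (FAnd f g) \<longleftrightarrow> sat I vN vI vL f \<and> sat I vN vI vL g"
| "sat I vN vI vL (FOr f g) \<longleftrightarrow> sat I vN vI vL f \<or> sat I vN vI vL g"
| "sat I vN vI vL (FImp f g) \<longleftrightarrow> (sat I vN vI vL f \<longrightarrow> sat I vN vI vL g)"
| "sat I vN vI vL (FAllN x f) \<longleftrightarrow> (\<forall>n. sat I (vN(x := n)) vI vL f)"
| "sat I vN vI vL (FAllI x f) \<longleftrightarrow> (\<forall>n. sat I vN (vI(x := n)) vL f)"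
| "sat I vN vI vL (FAllL x f) \<longleftrightarrow> (\<forall>t. sat I vN vI (vL(x := t)) f)"

definition models :: "'l interp \<Rightarrow> fm \<Rightarrow> bool" where
  "models I f \<longleftrightarrow> (\<forall>vN vI vL. sat I vN vI vL f)"


section \<open>Axiomatic semantics\<close>

text \<open>The argument \<open>ws\<close> below lists the labels of the enclosing loops, outermost first.\<close>

definition its :: "label list \<Rightarrow> nterm list" where
  "its ws = map NVar ws"

definition tp_while :: "label list \<Rightarrow> label \<Rightarrow> nterm \<Rightarrow> lterm" where
  "tp_while ws l t = Loc (At l) (its ws @ [t])"

definition start :: "label list \<Rightarrow> stmt \<Rightarrow> lterm" where
  "start ws s =
     (if is_while s then tp_while ws (label_of s) Zero else Loc (At (label_of s)) (its ws))"

definition start_ctx :: "label list \<Rightarrow> ctx \<Rightarrow> lterm" where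
  "start_ctx ws c = start ws (first_stmt c)"

definition end_tp :: lterm where
  "end_tp = Loc End []"

text \<open>All statement occurrences below a statement or context whose end timepoint is \<open>e\<close>;
  each occurrence comes with its enclosing loops and its own end timepoint.\<close>

primrec occs_stmt :: "label list \<Rightarrow> lterm \<Rightarrow> stmt \<Rightarrow> (label list \<times> stmt \<times> lterm) list"
  and occs_ctx :: "label list \<Rightarrow> lterm \<Rightarrow> ctx \<Rightarrow> (label list \<times> stmt \<times> lterm) list" where
  "occs_stmt ws e (Skip l) = [(ws, Skip l, e)]"
| "occs_stmt ws e (Assign l x a) = [(ws, Assign l x a, e)]"
| "occs_stmt ws e (ArrAssign l x a1 a2) = [(ws, ArrAssign l x a1 a2, e)]"
| "occs_stmt ws e (Ite l b c1 c2) =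
     (ws, Ite l b c1 c2, e) # occs_ctx ws e c1 @ occs_ctx ws e c2"
| "occs_stmt ws e (While l b c) =
     (ws, While l b c, e) # occs_ctx (ws @ [l]) (tp_while ws l (Succ (NVar l))) c"
| "occs_ctx ws e (Single s) = occs_stmt ws e s"
| "occs_ctx ws e (Seq s c) = occs_stmt ws (start_ctx ws c) s @ occs_ctx ws e c"

definition occs :: "program \<Rightarrow> (label list \<times> stmt \<times> lterm) list" where
  "occs p = occs_ctx [] end_tp (main p)"

primrec aexp_at :: "lterm \<Rightarrow> aexp \<Rightarrow> iterm" where
  "aexp_at tp (Num n) = IConst n"
| "aexp_at tp (IntVar x) = PInt x tp"
| "aexp_at tp (ArrAt x e) = PArr x tp (aexp_at tp e)"
| "aexp_at tp (CIntVar x) = PCInt x"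
| "aexp_at tp (CArrAt x e) = PCArr x (aexp_at tp e)"
| "aexp_at tp (Add e1 e2) = IAdd (aexp_at tp e1) (aexp_at tp e2)"
| "aexp_at tp (Sub e1 e2) = ISub (aexp_at tp e1) (aexp_at tp e2)"
| "aexp_at tp (Mul e1 e2) = IMul (aexp_at tp e1) (aexp_at tp e2)"

primrec bexp_at :: "lterm \<Rightarrow> bexp \<Rightarrow> fm" where
  "bexp_at tp BTrue = FTrue"
| "bexp_at tp (BEq e1 e2) = FEqI (aexp_at tp e1) (aexp_at tp e2)"
| "bexp_at tp (BLess e1 e2) = FLessI (aexp_at tp e1) (aexp_at tp e2)"
| "bexp_at tp (BNot b) = FNot (bexp_at tp b)"
| "bexp_at tp (BAnd b1 b2) = FAnd (bexp_at tp b1) (bexp_at tp b2)"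
| "bexp_at tp (BOr b1 b2) = FOr (bexp_at tp b1) (bexp_at tp b2)"

definition eq_int :: "vname \<Rightarrow> lterm \<Rightarrow> lterm \<Rightarrow> fm" where
  "eq_int x tp1 tp2 = FEqI (PInt x tp1) (PInt x tp2)"

definition eq_arr :: "vname \<Rightarrow> lterm \<Rightarrow> lterm \<Rightarrow> fm" where
  "eq_arr x tp1 tp2 = FAllI 0 (FEqI (PArr x tp1 (IVar 0)) (PArr x tp2 (IVar 0)))"

definition eq_all :: "program \<Rightarrow> lterm \<Rightarrow> lterm \<Rightarrow> fm" where
  "eq_all p tp1 tp2 =
     Conj (map (\<lambda>y. eq_int y tp1 tp2) (int_vars p) @ map (\<lambda>y. eq_arr y tp1 tp2) (arr_vars p))"

definition update :: "program \<Rightarrow> vname \<Rightarrow> aexp \<Rightarrow> lterm \<Rightarrow> lterm \<Rightarrow> fm" where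
  "update p x a tp1 tp2 =
     Conj (FEqI (PInt x tp2) (aexp_at tp1 a)
       # map (\<lambda>y. eq_int y tp1 tp2) (filter (\<lambda>y. y \<noteq> x) (int_vars p))
       @ map (\<lambda>y. eq_arr y tp1 tp2) (arr_vars p))"

definition update_arr :: "program \<Rightarrow> vname \<Rightarrow> aexp \<Rightarrow> aexp \<Rightarrow> lterm \<Rightarrow> lterm \<Rightarrow> fm" where
  "update_arr p x a1 a2 tp1 tp2 =
     Conj (FEqI (PArr x tp2 (aexp_at tp1 a1)) (aexp_at tp1 a2)
       # FAllI 0 (FImp (FNot (FEqI (IVar 0) (aexp_at tp1 a1)))
                       (FEqI (PArr x tp2 (IVar 0)) (PArr x tp1 (IVar 0))))
       # map (\<lambda>y. eq_int y tp1 tp2) (int_vars p)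
       @ map (\<lambda>y. eq_arr y tp1 tp2) (filter (\<lambda>y. y \<noteq> x) (arr_vars p)))"

primrec sem_stmt :: "program \<Rightarrow> label list \<Rightarrow> lterm \<Rightarrow> stmt \<Rightarrow> fm" where
  "sem_stmt p ws e (Skip l) = eq_all p e (start ws (Skip l))"
| "sem_stmt p ws e (Assign l x a) = update p x a (start ws (Assign l x a)) e"
| "sem_stmt p ws e (ArrAssign l x a1 a2) =
     update_arr p x a1 a2 (start ws (ArrAssign l x a1 a2)) e"
| "sem_stmt p ws e (Ite l b c1 c2) =
     (let st = start ws (Ite l b c1 c2) in
      Conj [FImp (bexp_at st b) (eq_all p (start_ctx ws c1) st),
            FImp (FNot (bexp_at st b)) (eq_all p (start_ctx ws c2) st)])"
| "sem_stmt p ws e (While l b c) =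
     (let it = NVar l; last = LastIt l (its ws) in
      Conj [FAllN l (FImp (FLessN it last) (bexp_at (tp_while ws l it) b)),
            FNot (bexp_at (tp_while ws l last) b),
            FAllN l (FImp (FLessN it last)
                          (eq_all p (start_ctx (ws @ [l]) c) (tp_while ws l it))),
            eq_all p e (tp_while ws l last)])"

definition ax_sem :: "program \<Rightarrow> fm" where
  "ax_sem p =
     Conj (map (\<lambda>(ws, s, e). foldr FAllN ws (FImp (FReach (start ws s)) (sem_stmt p ws e s)))
               (occs p))"


section \<open>Small-step operational semantics\<close>

record store =
  ints :: "vname \<Rightarrow> int"
  arrs :: "vname \<Rightarrow> int \<Rightarrow> int"
  cints :: "vname \<Rightarrow> int"
  carrs :: "vname \<Rightarrow> int \<Rightarrow> int"

primrec aval :: "store \<Rightarrow> aexp \<Rightarrow> int" where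
  "aval \<sigma> (Num n) = n"
| "aval \<sigma> (IntVar x) = ints \<sigma> x"
| "aval \<sigma> (ArrAt x e) = arrs \<sigma> x (aval \<sigma> e)"
| "aval \<sigma> (CIntVar x) = cints \<sigma> x"
| "aval \<sigma> (CArrAt x e) = carrs \<sigma> x (aval \<sigma> e)"
| "aval \<sigma> (Add e1 e2) = aval \<sigma> e1 + aval \<sigma> e2"
| "aval \<sigma> (Sub e1 e2) = aval \<sigma> e1 - aval \<sigma> e2"
| "aval \<sigma> (Mul e1 e2) = aval \<sigma> e1 * aval \<sigma> e2"

primrec bval :: "store \<Rightarrow> bexp \<Rightarrow> bool" where
  "bval \<sigma> BTrue = True"
| "bval \<sigma> (BEq e1 e2) = (aval \<sigma> e1 = aval \<sigma> e2)"
| "bval \<sigma> (BLess e1 e2) = (aval \<sigma> e1 < aval \<sigma> e2)"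
| "bval \<sigma> (BNot b) = (\<not> bval \<sigma> b)"
| "bval \<sigma> (BAnd b1 b2) = (bval \<sigma> b1 \<and> bval \<sigma> b2)"
| "bval \<sigma> (BOr b1 b2) = (bval \<sigma> b1 \<or> bval \<sigma> b2)"

text \<open>A configuration consists of the statements that remain to be executed and a store.
  Each pending statement carries the iterations of its enclosing loops; for a loop,
  the list additionally ends with the number of the loop's own current iteration.\<close>

type_synonym frame = "stmt \<times> nat list"
type_synonym config = "frame list \<times> store"

definition enter :: "nat list \<Rightarrow> ctx \<Rightarrow> frame list" where
  "enter ks c = map (\<lambda>s. (s, if is_while s then ks @ [0] else ks)) (stmts c)"

inductive step :: "config \<Rightarrow> config \<Rightarrow> bool" where
  step_skip: "step ((Skip l, ks) # K, \<sigma>) (K, \<sigma>)"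
| step_assign:
    "step ((Assign l x a, ks) # K, \<sigma>) (K, \<sigma>\<lparr>ints := (ints \<sigma>)(x := aval \<sigma> a)\<rparr>)"
| step_arr_assign:
    "step ((ArrAssign l x a1 a2, ks) # K, \<sigma>)
          (K, \<sigma>\<lparr>arrs := (arrs \<sigma>)(x := (arrs \<sigma> x)(aval \<sigma> a1 := aval \<sigma> a2))\<rparr>)"
| step_ite_true:
    "bval \<sigma> b \<Longrightarrow> step ((Ite l b c1 c2, ks) # K, \<sigma>) (enter ks c1 @ K, \<sigma>)"
| step_ite_false:
    "\<not> bval \<sigma> b \<Longrightarrow> step ((Ite l b c1 c2, ks) # K, \<sigma>) (enter ks c2 @ K, \<sigma>)"
| step_while_true:
    "bval \<sigma> b \<Longrightarrow>
     step ((While l b c, ks @ [k]) # K, \<sigma>)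
          (enter (ks @ [k]) c @ (While l b c, ks @ [Suc k]) # K, \<sigma>)"
| step_while_false:
    "\<not> bval \<sigma> b \<Longrightarrow> step ((While l b c, ks @ [k]) # K, \<sigma>) (K, \<sigma>)"

type_synonym timepoint = "location \<times> nat list"

definition timepoint_of :: "config \<Rightarrow> timepoint" where
  "timepoint_of c =
     (case fst c of [] \<Rightarrow> (End, []) | (s, ks) # K \<Rightarrow> (At (label_of s), ks))"

text \<open>A run is a maximal sequence of transitions from an initial configuration with an
  arbitrary store. A finite run is extended by repeating its last configuration.\<close>

definition run :: "program \<Rightarrow> (nat \<Rightarrow> config) \<Rightarrow> bool" where
  "run p r \<longleftrightarrow>
     (\<exists>\<sigma>. r 0 = (enter [] (main p), \<sigma>)) \<and>
     (\<forall>i. step (r i) (r (Suc i)) \<or> (\<nexists>c. step (r i) c) \<and> r (Suc i) = r i)"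

definition reached :: "(nat \<Rightarrow> config) \<Rightarrow> timepoint set" where
  "reached r = range (\<lambda>i. timepoint_of (r i))"

definition timepoints :: "program \<Rightarrow> timepoint set" where
  "timepoints p =
     insert (End, [])
       {(At (label_of s), ks) | ws s e ks.
          (ws, s, e) \<in> set (occs p) \<and>
          length ks = (if is_while s then Suc (length ws) else length ws)}"


section \<open>Execution interpretations\<close>

definition denot :: "'l interp \<Rightarrow> timepoint \<Rightarrow> 'l" where
  "denot I tp = loc_of I (fst tp) (snd tp)"

definition interp_reach :: "program \<Rightarrow> (nat \<Rightarrow> config) \<Rightarrow> 'l interp \<Rightarrow> bool" where
  "interp_reach p r I \<longleftrightarrow>
     (\<forall>tp \<in> timepoints p. reach_of I (denot I tp) \<longleftrightarrow> tp \<in> reached r)"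

definition interp_vars :: "program \<Rightarrow> (nat \<Rightarrow> config) \<Rightarrow> 'l interp \<Rightarrow> bool" where
  "interp_vars p r I \<longleftrightarrow>
     (\<forall>i. let tp = denot I (timepoint_of (r i)); \<sigma> = snd (r i) in
        (\<forall>x \<in> set (int_vars p). int_of I x tp = ints \<sigma> x) \<and>
        (\<forall>x \<in> set (arr_vars p). arr_of I x tp = arrs \<sigma> x) \<and>
        (\<forall>x \<in> set (const_ints p). cint_of I x = cints \<sigma> x) \<and>
        (\<forall>x \<in> set (const_arrs p). carr_of I x = carrs \<sigma> x))"

text \<open>For every reached instance of a loop, the last-iteration symbol denotes the greatest
  iteration whose loop head is reached. A run in which some loop instance iterates forever
  has no such iteration, hence induces no execution interpretation.\<close>

definition interp_last :: "(nat \<Rightarrow> config) \<Rightarrow> 'l interp \<Rightarrow> bool" where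
  "interp_last r I \<longleftrightarrow>
     (\<forall>i l b c ks k K \<sigma>. r i = ((While l b c, ks @ [k]) # K, \<sigma>) \<longrightarrow>
        (At l, ks @ [last_of I l ks]) \<in> reached r \<and> k \<le> last_of I l ks)"

definition execution_interp :: "program \<Rightarrow> 'l interp \<Rightarrow> bool" where
  "execution_interp p I \<longleftrightarrow>
     (\<exists>r. run p r \<and> interp_reach p r I \<and> interp_vars p r I \<and> interp_last r I)"

end

theory Submission
  imports Defs
begin

text \<open>Along a run, every pending statement is an occurrence in the program, and the timepoint
  of the stack below it is the denotation of its end term. So each axiom compares the stores
  of two configurations of the run. For a loop, iterations are traced backwards from the
  last one: a head in iteration \<open>k + 1\<close> is preceded by a head in iteration \<open>k\<close>, above the same
  stack, at which the condition holds. The condition fails in the last iteration because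
  otherwise the body, which terminates since every loop instance has a last iteration, would
  lead to one more iteration.\<close>

section \<open>Occurrences\<close>

lemma labels_occs:
  "map (\<lambda>(ws, s, e). label_of s) (occs_stmt ws e s) = labels_stmt s"
  "map (\<lambda>(ws, s, e). label_of s) (occs_ctx ws e c) = labels_ctx c"
  by (induction s and c arbitrary: ws e and ws e) auto

text \<open>Listed in order, the labels of the occurrences are the labels of the program, which are
  distinct. So the label in a timepoint fixes the statement, its enclosing loops and its end
  term.\<close>

lemma occs_unique:
  assumes "wf_program p" "(ws, s, e) \<in> set (occs p)" "(ws', s', e') \<in> set (occs p)"
    "label_of s = label_of s'"
  shows "ws' = ws \<and> s' = s \<and> e' = e"
proof -
  have "distinct (map (\<lambda>(ws, s, e). label_of s) (occs p))"
    using assms(1) by (simp add: occs_def labels_occs wf_program_def)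
  then have "inj_on (\<lambda>(ws, s, e). label_of s) (set (occs p))"
    by (simp add: distinct_map)
  from inj_onD[OF this _ assms(2,3)] assms(4) show ?thesis by simp
qed

lemma decl_occs:
  "decl_stmt p s \<Longrightarrow> (ws', s', e') \<in> set (occs_stmt ws e s) \<Longrightarrow> decl_stmt p s'"
  "decl_ctx p c \<Longrightarrow> (ws', s', e') \<in> set (occs_ctx ws e c) \<Longrightarrow> decl_stmt p s'"
  by (induction s and c arbitrary: ws e and ws e) auto

text \<open>Needed for loop axioms: binding the loop's own iteration variable must not change the
  values of \<open>its ws\<close>. Descending into a body moves the loop label from the inner labels
  to \<open>ws\<close>, and distinctness keeps the two disjoint.\<close>

lemma label_not_enclosing:
  "distinct (labels_stmt s) \<Longrightarrow> set ws \<inter> set (labels_stmt s) = {} \<Longrightarrow>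
     (ws', s', e') \<in> set (occs_stmt ws e s) \<Longrightarrow> label_of s' \<notin> set ws'"
  "distinct (labels_ctx c) \<Longrightarrow> set ws \<inter> set (labels_ctx c) = {} \<Longrightarrow>
     (ws', s', e') \<in> set (occs_ctx ws e c) \<Longrightarrow> label_of s' \<notin> set ws'"
proof (induction s and c arbitrary: ws e and ws e)
  case (Ite l b c1 c2)
  have "set ws \<inter> set (labels_ctx c1) = {}" "set ws \<inter> set (labels_ctx c2) = {}"
    using Ite.prems(2) by auto
  then show ?case
    using Ite.IH(1)[of ws e] Ite.IH(2)[of ws e] Ite.prems by auto
next
  case (While l b c)
  have "set (ws @ [l]) \<inter> set (labels_ctx c) = {}"
    using While.prems(1,2) by auto
  then show ?case
    using While.IH[of "ws @ [l]"] While.prems by auto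
next
  case (Seq s c)
  have "set ws \<inter> set (labels_stmt s) = {}" "set ws \<inter> set (labels_ctx c) = {}"
    using Seq.prems(2) by auto
  then show ?case
    using Seq.IH(1)[of ws "start_ctx ws c"] Seq.IH(2)[of ws e] Seq.prems by auto
qed auto

lemma occs_stmt_refl: "(ws, s, e) \<in> set (occs_stmt ws e s)"
  by (cases s) auto

text \<open>Ensures that branches and bodies entered during a run again consist of occurrences of
  the program.\<close>

lemma occs_trans:
  "(ws', s', e') \<in> set (occs_stmt ws e s) \<Longrightarrow>
     set (occs_stmt ws' e' s') \<subseteq> set (occs_stmt ws e s)"
  "(ws', s', e') \<in> set (occs_ctx ws e c) \<Longrightarrow>
     set (occs_stmt ws' e' s') \<subseteq> set (occs_ctx ws e c)"
proof (induction s and c arbitrary: ws e and ws e)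
  case (Ite l b c1 c2)
  then show ?case
    using Ite.IH(1)[of ws e] Ite.IH(2)[of ws e] by fastforce
next
  case (While l b c)
  then show ?case
    using While.IH[of "ws @ [l]" "tp_while ws l (Succ (NVar l))"] by fastforce
next
  case (Seq s c)
  then show ?case
    using Seq.IH(1)[of ws "start_ctx ws c"] Seq.IH(2)[of ws e] by fastforce
qed auto

lemma occs_subset: "(ws, s, e) \<in> set (occs p) \<Longrightarrow> set (occs_stmt ws e s) \<subseteq> set (occs p)"
  by (simp add: occs_def occs_trans)

section \<open>Satisfaction of the axioms\<close>

lemma sat_Conj [simp]: "sat I vN vI vL (Conj fs) \<longleftrightarrow> (\<forall>f \<in> set fs. sat I vN vI vL f)"
  unfolding Conj_def by (induction fs) auto

lemma sat_foldr_FAllN: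
  "(\<And>vN. sat I vN vI vL f) \<Longrightarrow> sat I vN vI vL (foldr FAllN xs f)"
  by (induction xs arbitrary: vN) auto

lemma nval_its [simp]: "map (nval I vN) (its ws) = map vN ws"
  by (simp add: its_def)

text \<open>The condition of \<open>interp_vars\<close> for one store, with the timepoint abstracted
  to any domain element so that it applies to the value of a term.\<close>

definition agrees :: "program \<Rightarrow> 'l interp \<Rightarrow> store \<Rightarrow> 'l \<Rightarrow> bool" where
  "agrees p I \<sigma> t \<longleftrightarrow>
     (\<forall>x \<in> set (int_vars p). int_of I x t = ints \<sigma> x) \<and>
     (\<forall>x \<in> set (arr_vars p). arr_of I x t = arrs \<sigma> x) \<and>
     (\<forall>x \<in> set (const_ints p). cint_of I x = cints \<sigma> x) \<and>
     (\<forall>x \<in> set (const_arrs p). carr_of I x = carrs \<sigma> x)"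

lemma ival_aexp_at:
  "agrees p I \<sigma> (lval I vN vL tp) \<Longrightarrow> decl_aexp p a \<Longrightarrow>
   ival I vN vI vL (aexp_at tp a) = aval \<sigma> a"
  by (induction a) (auto simp: agrees_def)

lemma sat_bexp_at:
  "agrees p I \<sigma> (lval I vN vL tp) \<Longrightarrow> decl_bexp p b \<Longrightarrow>
   sat I vN vI vL (bexp_at tp b) \<longleftrightarrow> bval \<sigma> b"
  by (induction b) (auto simp: ival_aexp_at)

text \<open>One store is visible at both timepoints. This serves every clause without an update:
  skip, entering a branch or body, leaving a loop.\<close>

lemma sat_eq_all:
  "agrees p I \<sigma> (lval I vN vL tp1) \<Longrightarrow> agrees p I \<sigma> (lval I vN vL tp2) \<Longrightarrow>
   sat I vN vI vL (eq_all p tp1 tp2)"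
  by (auto simp: eq_all_def eq_int_def eq_arr_def agrees_def)

lemma sat_update:
  assumes "agrees p I \<sigma> (lval I vN vL tp1)"
    "agrees p I (\<sigma>\<lparr>ints := (ints \<sigma>)(x := aval \<sigma> a)\<rparr>) (lval I vN vL tp2)"
    "x \<in> set (int_vars p)" "decl_aexp p a"
  shows "sat I vN vI vL (update p x a tp1 tp2)"
  using assms ival_aexp_at[OF assms(1,4)]
  by (auto simp: update_def eq_int_def eq_arr_def agrees_def)

lemma sat_update_arr:
  assumes "agrees p I \<sigma> (lval I vN vL tp1)"
    "agrees p I (\<sigma>\<lparr>arrs := (arrs \<sigma>)(x := (arrs \<sigma> x)(aval \<sigma> a1 := aval \<sigma> a2))\<rparr>)
       (lval I vN vL tp2)"
    "x \<in> set (arr_vars p)" "decl_aexp p a1" "decl_aexp p a2"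
  shows "sat I vN vI vL (update_arr p x a1 a2 tp1 tp2)"
  using assms ival_aexp_at[OF assms(1,4)] ival_aexp_at[OF assms(1,5)]
  by (auto simp: update_arr_def eq_int_def eq_arr_def agrees_def)

section \<open>Runs\<close>

lemma step_deterministic: "step c d \<Longrightarrow> step c d' \<Longrightarrow> d = d'"
  by (induction rule: step.induct) (auto elim: step.cases)

text \<open>A run repeats a configuration only where no step exists, so by determinism any step
  exhibited is the one taken.\<close>

lemma run_step: "run p r \<Longrightarrow> step (r i) d \<Longrightarrow> r (Suc i) = d"
  unfolding run_def using step_deterministic by blast

lemma timepoint_of_Nil [simp]: "timepoint_of ([], \<sigma>) = (End, [])"
  and timepoint_of_Cons [simp]: "timepoint_of ((s, ks) # K, \<sigma>) = (At (label_of s), ks)"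
  by (simp_all add: timepoint_of_def)

lemma enter_Single [simp]: "enter ks (Single s) = [(s, if is_while s then ks @ [0] else ks)]"
  and enter_Seq [simp]: "enter ks (Seq s c) = (s, if is_while s then ks @ [0] else ks) # enter ks c"
  by (simp_all add: enter_def)

lemma lval_start:
  "lval I vN vL (start ws s) =
     denot I (At (label_of s), if is_while s then map vN ws @ [0] else map vN ws)"
  by (simp add: start_def tp_while_def denot_def)

text \<open>Contexts are nonempty, so the timepoint is that of the first entered statement, whatever
  \<open>K\<close> and \<open>\<sigma>\<close> are; a loop is entered in iteration 0 on both
  sides.\<close>

lemma lval_start_ctx:
  "lval I vN vL (start_ctx ws c) = denot I (timepoint_of (enter (map vN ws) c @ K, \<sigma>))"
  by (cases c) (simp_all add: start_ctx_def lval_start)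

section \<open>Stack invariant and termination of pending statements\<close>

locale execution =
  fixes p :: program and r :: "nat \<Rightarrow> config" and I :: "'l interp"
  assumes wf: "wf_program p"
    and run: "run p r"
    and reach: "interp_reach p r I"
    and vars: "interp_vars p r I"
    and last: "interp_last r I"
begin

text \<open>The first conjunct ties the end term to the stack below; \<open>take\<close> strips a
  loop's own iteration. The second keeps the history of a loop: a head in a later iteration has a
  predecessor above the same stack.\<close>

definition frame_ok :: "frame \<Rightarrow> frame list \<Rightarrow> bool" where
  "frame_ok f K \<longleftrightarrow>
     (\<exists>ws e. (ws, fst f, e) \<in> set (occs p) \<and>
        length (snd f) = (if is_while (fst f) then Suc (length ws) else length ws) \<and>
        (\<forall>vN vL \<sigma>. map vN ws = take (length ws) (snd f) \<longrightarrow>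
           lval I vN vL e = denot I (timepoint_of (K, \<sigma>)))) \<and>
     (\<forall>l b c ks k. f = (While l b c, ks @ [Suc k]) \<longrightarrow>
        (\<exists>j \<sigma>. r j = ((While l b c, ks @ [k]) # K, \<sigma>) \<and> bval \<sigma> b))"

primrec stack_ok :: "frame list \<Rightarrow> bool" where
  "stack_ok [] = True"
| "stack_ok (f # K) = (frame_ok f K \<and> stack_ok K)"

text \<open>An entered loop is in iteration 0, so the history conjunct holds vacuously.\<close>

lemma frame_ok_enter:
  assumes "(ws, s, e) \<in> set (occs p)" "length ks = length ws"
    "\<And>vN vL \<sigma>. map vN ws = ks \<Longrightarrow> lval I vN vL e = denot I (timepoint_of (K, \<sigma>))"
  shows "frame_ok (s, if is_while s then ks @ [0] else ks) K"
  unfolding frame_ok_def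
  by (rule conjI, rule exI[of _ ws], rule exI[of _ e]) (use assms in auto)

lemma stack_ok_enter:
  assumes "set (occs_ctx ws e c) \<subseteq> set (occs p)" "length ks = length ws"
    "\<And>vN vL \<sigma>. map vN ws = ks \<Longrightarrow> lval I vN vL e = denot I (timepoint_of (K, \<sigma>))"
    "stack_ok K"
  shows "stack_ok (enter ks c @ K)"
  using assms
proof (induction c rule: ctx.induct[where ?P1.0 = "\<lambda>_. True"])
  case (Single s)
  then have "(ws, s, e) \<in> set (occs p)"
    using occs_stmt_refl by fastforce
  from frame_ok_enter[OF this Single.prems(2,3)] Single.prems(4) show ?case by simp
next
  case (Seq s c)
  then have occ: "(ws, s, start_ctx ws c) \<in> set (occs p)"
    using occs_stmt_refl by fastforce
  \<comment> \<open>The end term of \<open>s\<close> is the start of \<open>c\<close>, and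
    \<open>c\<close> is what lies directly below \<open>s\<close> on the stack.\<close>
  have "frame_ok (s, if is_while s then ks @ [0] else ks) (enter ks c @ K)"
    by (rule frame_ok_enter[OF occ Seq.prems(2)]) (use lval_start_ctx in metis)
  moreover have "stack_ok (enter ks c @ K)"
    using Seq by simp
  ultimately show ?case by simp
qed auto

lemma stack_ok_run: "stack_ok (fst (r i))"
proof (induction i)
  case 0
  obtain \<sigma> where "r 0 = (enter [] (main p), \<sigma>)"
    using run by (auto simp: run_def)
  \<comment> \<open>The bottom of the stack is empty; its timepoint is the end of the program,
    denoted by \<open>end_tp\<close>.\<close>
  moreover have "stack_ok (enter [] (main p) @ [])"
    by (rule stack_ok_enter[of "[]" end_tp]) (auto simp: occs_def end_tp_def denot_def)
  ultimately show ?case by simp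
next
  case (Suc i)
  have "step (r i) (r (Suc i)) \<or> r (Suc i) = r i"
    using run by (auto simp: run_def)
  then show ?case
  proof
    assume "step (r i) (r (Suc i))"
    then show ?thesis
    proof cases
      case (step_ite_true \<sigma> b l c1 c2 ks K)
      then obtain ws e where occ: "(ws, Ite l b c1 c2, e) \<in> set (occs p)" "length ks = length ws"
        and e: "\<And>vN vL \<sigma>. map vN ws = ks \<Longrightarrow> lval I vN vL e = denot I (timepoint_of (K, \<sigma>))"
        and K: "stack_ok K"
        using Suc by (auto simp: frame_ok_def)
      have "stack_ok (enter ks c1 @ K)"
        by (rule stack_ok_enter[OF _ occ(2) e K]) (use occs_subset[OF occ(1)] in auto)
      then show ?thesis using step_ite_true by simp
    next
      case (step_ite_false \<sigma> b l c1 c2 ks K)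
      then obtain ws e where occ: "(ws, Ite l b c1 c2, e) \<in> set (occs p)" "length ks = length ws"
        and e: "\<And>vN vL \<sigma>. map vN ws = ks \<Longrightarrow> lval I vN vL e = denot I (timepoint_of (K, \<sigma>))"
        and K: "stack_ok K"
        using Suc by (auto simp: frame_ok_def)
      have "stack_ok (enter ks c2 @ K)"
        by (rule stack_ok_enter[OF _ occ(2) e K]) (use occs_subset[OF occ(1)] in auto)
      then show ?thesis using step_ite_false by simp
    next
      case (step_while_true \<sigma> b l c ks k K)
      then obtain ws e where occ: "(ws, While l b c, e) \<in> set (occs p)" "length ks = length ws"
        and e: "\<And>vN vL \<sigma>. map vN ws = ks \<Longrightarrow> lval I vN vL e = denot I (timepoint_of (K, \<sigma>))"
        and K: "stack_ok K"
        using Suc by (auto simp: frame_ok_def)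
      \<comment> \<open>The current configuration \<open>r i\<close> is itself the predecessor that
        the history conjunct asks for.\<close>
      have "frame_ok (While l b c, ks @ [Suc k]) K"
        unfolding frame_ok_def
      proof (intro conjI exI)
        show "(ws, fst (While l b c, ks @ [Suc k]), e) \<in> set (occs p)"
          using occ by simp
      qed (use occ e step_while_true in auto)
      with K have K': "stack_ok ((While l b c, ks @ [Suc k]) # K)" by simp
      \<comment> \<open>With \<open>NVar l\<close> valued \<open>k\<close>, the end term of the body
        is the head in iteration \<open>Suc k\<close>, which is the frame below the body.\<close>
      have "stack_ok (enter (ks @ [k]) c @ (While l b c, ks @ [Suc k]) # K)"
        by (rule stack_ok_enter[OF _ _ _ K', of "ws @ [l]" "tp_while ws l (Succ (NVar l))"])
          (use occ occs_subset[OF occ(1)] in \<open>auto simp: tp_while_def denot_def\<close>)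
      then show ?thesis using step_while_true by simp
    qed (use Suc in auto)
  qed (use Suc in auto)
qed

text \<open>Structural induction; only loops could diverge, and \<open>interp_last\<close> bounds
  their iterations. A loop frame must carry its own iteration, since otherwise it may have no
  step.\<close>

lemma terminates:
  "(is_while s \<Longrightarrow> ks \<noteq> []) \<Longrightarrow> r i = ((s, ks) # K, \<sigma>) \<Longrightarrow> \<exists>j \<sigma>'. r j = (K, \<sigma>')"
  "r i = (enter ks c @ K, \<sigma>) \<Longrightarrow> \<exists>j \<sigma>'. r j = (K, \<sigma>')"
proof (induction s and c arbitrary: i ks K \<sigma> and i ks K \<sigma>)
  case (Skip l)
  then show ?case using run_step[OF run] step_skip by metis
next
  case (Assign l x a)
  then show ?case using run_step[OF run] step_assign by metis
next
  case (ArrAssign l x a1 a2)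
  then show ?case using run_step[OF run] step_arr_assign by metis
next
  case (Ite l b c1 c2)
  then show ?case
    using run_step[OF run] step_ite_true step_ite_false by metis
next
  case (While l b c)
  obtain js k where ks: "ks = js @ [k]"
    using While.prems(1) by (cases ks rule: rev_cases) auto
  have "r i = ((While l b c, js @ [k]) # K, \<sigma>) \<Longrightarrow> ?case"
  \<comment> \<open>Inner induction on the iterations left; \<open>js\<close> stays fixed, so all
    heads share one bound.\<close>
  proof (induction "Suc (last_of I l js) - k" arbitrary: i k \<sigma> rule: less_induct)
    case less
    show ?case
    proof (cases "bval \<sigma> b")
      case True
      then have "r (Suc i) = (enter (js @ [k]) c @ (While l b c, js @ [Suc k]) # K, \<sigma>)"
        using less.prems run_step[OF run] step_while_true by metis
      then obtain j \<sigma>' where j: "r j = ((While l b c, js @ [Suc k]) # K, \<sigma>')"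
        using While.IH by blast
      \<comment> \<open>The next head is reached and hence bounded, so the truncated difference
        strictly decreases.\<close>
      then have "Suc k \<le> last_of I l js"
        using last unfolding interp_last_def by blast
      then show ?thesis using less.hyps[OF _ j] by simp
    next
      case False
      then show ?thesis using less.prems run_step[OF run] step_while_false by metis
    qed
  qed
  with While.prems(2) ks show ?case by simp
next
  case (Single s)
  have "r i = ((s, if is_while s then ks @ [0] else ks) # K, \<sigma>)"
    using Single.prems by simp
  then show ?case by (rule Single.IH[rotated]) simp
next
  case (Seq s c)
  have "\<exists>j \<sigma>'. r j = (enter ks c @ K, \<sigma>')"
    by (rule Seq.IH(1)[OF _ Seq.prems[simplified]]) auto
  then show ?case using Seq.IH(2) by blast
qed

section \<open>From reached timepoints to satisfied axioms\<close>

lemma agrees_run: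
  assumes "r i = (K, \<sigma>)"
  shows "agrees p I \<sigma> (denot I (timepoint_of (K, \<sigma>)))"
  using vars assms unfolding interp_vars_def agrees_def Let_def by (metis snd_conv)

text \<open>A timepoint shows only a label and iterations. Uniqueness of labels recovers the
  statement on top, and the stack invariant the meaning of its end term.\<close>

lemma reached_occ:
  assumes occ: "(ws, s, e) \<in> set (occs p)" and tp: "(At (label_of s), ks) \<in> reached r"
  obtains i K \<sigma> where "r i = ((s, ks) # K, \<sigma>)"
    and "\<And>vN vL \<sigma>. map vN ws = take (length ws) ks \<Longrightarrow>
           lval I vN vL e = denot I (timepoint_of (K, \<sigma>))"
proof -
  obtain i where i: "(At (label_of s), ks) = timepoint_of (r i)"
    using tp by (auto simp: reached_def)
  then obtain s' K \<sigma> where r: "r i = ((s', ks) # K, \<sigma>)" and l: "label_of s' = label_of s"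
    by (auto simp: timepoint_of_def split: list.splits prod.splits)
      (metis prod.collapse)
  have ok: "stack_ok ((s', ks) # K)"
    using stack_ok_run[of i] r by simp
  then obtain ws' e' where occ': "(ws', s', e') \<in> set (occs p)"
    and e': "\<And>vN vL \<sigma>. map vN ws' = take (length ws') ks \<Longrightarrow>
           lval I vN vL e' = denot I (timepoint_of (K, \<sigma>))"
    by (auto simp: frame_ok_def)
  have "ws' = ws \<and> s' = s \<and> e' = e"
    using occs_unique[OF wf occ occ'] l by simp
  with that r e' show ?thesis by blast
qed

text \<open>Follows the history conjunct of \<open>frame_ok\<close> backwards from iteration
  \<open>k\<close>. Only heads before \<open>k\<close> are known to satisfy the condition.\<close>

lemma loop_heads:
  assumes "r i = ((While l b c, ks @ [k]) # K, \<sigma>)" "n \<le> k"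
  shows "\<exists>j \<sigma>'. r j = ((While l b c, ks @ [n]) # K, \<sigma>') \<and> (n < k \<longrightarrow> bval \<sigma>' b)"
  using assms
proof (induction k arbitrary: i \<sigma>)
  case (Suc k)
  show ?case
  proof (cases "n = Suc k")
    case False
    obtain j \<sigma>' where j: "r j = ((While l b c, ks @ [k]) # K, \<sigma>')" "bval \<sigma>' b"
      using stack_ok_run[of i] Suc.prems(1) by (auto simp: frame_ok_def)
    show ?thesis
    proof (cases "n = k")
      case True
      with j show ?thesis by blast
    next
      case neq: False
      then show ?thesis using Suc.IH[OF j(1)] False Suc.prems(2) by auto
    qed
  qed (use Suc.prems in auto)
qed auto

lemma sat_sem_while:
  assumes occ: "(ws, While l b c, e) \<in> set (occs p)"
    and tp: "(At l, map vN ws @ [0]) \<in> reached r"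
    and decl: "decl_bexp p b" and l: "l \<notin> set ws"
  shows "sat I vN vI vL (sem_stmt p ws e (While l b c))"
proof -
  define ks where "ks = map vN ws"
  define L where "L = last_of I l ks"
  obtain i0 K0 \<sigma>0 where "r i0 = ((While l b c, ks @ [0]) # K0, \<sigma>0)"
    using reached_occ[OF occ] tp unfolding ks_def by (metis label_of.simps(5))
  then have "(At l, ks @ [L]) \<in> reached r"
    using last unfolding interp_last_def L_def by blast
  \<comment> \<open>All clauses are read off from this head in the last iteration: earlier heads by
    going back, the loop exit by one step forward.\<close>
  then obtain m K \<sigma> where m: "r m = ((While l b c, ks @ [L]) # K, \<sigma>)"
    and e: "\<And>vN vL \<sigma>. map vN ws = take (length ws) (ks @ [L]) \<Longrightarrow>
           lval I vN vL e = denot I (timepoint_of (K, \<sigma>))"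
    using reached_occ[OF occ] by (metis label_of.simps(5))
  have false: "\<not> bval \<sigma> b"
  proof
    assume "bval \<sigma> b"
    then have "r (Suc m) = (enter (ks @ [L]) c @ (While l b c, ks @ [Suc L]) # K, \<sigma>)"
      using m run_step[OF run] step_while_true by metis
    then obtain j \<sigma>' where "r j = ((While l b c, ks @ [Suc L]) # K, \<sigma>')"
      using terminates(2) by blast
    then have "Suc L \<le> last_of I l ks"
      using last unfolding interp_last_def by blast
    then show False by (simp add: L_def)
  qed
  \<comment> \<open>Quantifying over the loop's own iteration leaves the enclosing iterations, and
    hence the value of \<open>LastIt\<close>, unchanged.\<close>
  have ks_upd: "map (vN(l := n)) ws = ks" for n
    using l by (simp add: ks_def)
  have head: "lval I vN' vL (tp_while ws l t) = denot I (At l, map vN' ws @ [nval I vN' t])"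
    for vN' t by (simp add: tp_while_def denot_def)
  have agrees_head: "agrees p I \<sigma>' (denot I (At l, ks @ [n]))"
    if "r j = ((While l b c, ks @ [n]) # K, \<sigma>')" for j n \<sigma>'
    using agrees_run[OF that] by simp
  have iter: "sat I (vN(l := n)) vI vL (bexp_at (tp_while ws l (NVar l)) b) \<and>
      sat I (vN(l := n)) vI vL (eq_all p (start_ctx (ws @ [l]) c) (tp_while ws l (NVar l)))"
    if "n < L" for n
  proof -
    obtain j \<sigma>' where j: "r j = ((While l b c, ks @ [n]) # K, \<sigma>')" and b: "bval \<sigma>' b"
      using loop_heads[OF m, of n] \<open>n < L\<close> by auto
    have ag: "agrees p I \<sigma>' (lval I (vN(l := n)) vL (tp_while ws l (NVar l)))"
      unfolding head ks_upd using agrees_head[OF j] by simp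
    have "r (Suc j) = (enter (ks @ [n]) c @ (While l b c, ks @ [Suc n]) # K, \<sigma>')"
      using j b run_step[OF run] step_while_true by metis
    from agrees_run[OF this]
    have "agrees p I \<sigma>' (lval I (vN(l := n)) vL (start_ctx (ws @ [l]) c))"
      using lval_start_ctx[of I "vN(l := n)" vL "ws @ [l]" c] ks_upd[of n]
      by (metis fun_upd_same list.simps(8,9) map_append)
    then show ?thesis
      using sat_bexp_at[OF ag decl] b sat_eq_all ag by blast
  qed
  have last_val: "last_of I l (map (vN(l := n)) ws) = L" "last_of I l (map vN ws) = L" for n
    unfolding ks_upd by (simp_all add: L_def ks_def)
  have ag: "agrees p I \<sigma> (lval I vN vL (tp_while ws l (LastIt l (its ws))))"
    unfolding head using agrees_head[OF m] by (simp add: last_val ks_def)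
  \<comment> \<open>The exit step pops the loop without changing the store, so the last head and the
    end show the same values.\<close>
  have "r (Suc m) = (K, \<sigma>)"
    using m false run_step[OF run] step_while_false by metis
  from agrees_run[OF this] have "agrees p I \<sigma> (lval I vN vL e)"
    using e[of vN vL] by (simp add: ks_def)
  then show ?thesis
    using iter ag false sat_bexp_at[OF ag decl] sat_eq_all[OF _ ag]
    by (simp add: Let_def last_val)
qed

lemma sat_sem_stmt:
  assumes occ: "(ws, s, e) \<in> set (occs p)"
    and reached: "reach_of I (lval I vN vL (start ws s))"
  shows "sat I vN vI vL (sem_stmt p ws e s)"
proof -
  define ks where "ks = (if is_while s then map vN ws @ [0] else map vN ws)"
  have start: "lval I vN vL (start ws s) = denot I (At (label_of s), ks)"
    by (simp add: lval_start ks_def)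
  \<comment> \<open>\<open>interp_reach\<close> constrains the predicate only on timepoints of the
    program, so membership comes first.\<close>
  have "(At (label_of s), ks) \<in> timepoints p"
    using occ by (force simp: timepoints_def ks_def)
  then have tp: "(At (label_of s), ks) \<in> reached r"
    using reach reached start by (simp add: interp_reach_def)
  obtain i K \<sigma> where i: "r i = ((s, ks) # K, \<sigma>)"
    and e: "\<And>vN vL \<sigma>. map vN ws = take (length ws) ks \<Longrightarrow>
           lval I vN vL e = denot I (timepoint_of (K, \<sigma>))"
    using reached_occ[OF occ tp] by metis
  \<comment> \<open>Timepoints ignore the store, so any step that pops \<open>s\<close> arrives at
    the end term.\<close>
  have lval_e: "lval I vN vL e = denot I (timepoint_of (K, \<sigma>'))" for \<sigma>'
    by (rule e) (simp add: ks_def)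
  have ag: "agrees p I \<sigma> (lval I vN vL (start ws s))"
    using agrees_run[OF i] start by simp
  have decl: "decl_stmt p s"
    using wf occ decl_occs(2) unfolding wf_program_def occs_def by blast
  have ag_e: "agrees p I \<sigma>' (lval I vN vL e)" if "step (r i) (K, \<sigma>')" for \<sigma>'
    using agrees_run[OF run_step[OF run that]] lval_e by simp
  show ?thesis
  proof (cases s)
    case (Skip l)
    have "agrees p I \<sigma> (lval I vN vL e)"
      by (rule ag_e) (simp add: i Skip step_skip)
    with ag Skip show ?thesis by (simp add: sat_eq_all)
  next
    case (Assign l x a)
    have "agrees p I (\<sigma>\<lparr>ints := (ints \<sigma>)(x := aval \<sigma> a)\<rparr>) (lval I vN vL e)"
      by (rule ag_e) (simp add: i Assign step_assign)
    with ag decl Assign show ?thesis by (simp add: sat_update)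
  next
    case (ArrAssign l x a1 a2)
    have "agrees p I (\<sigma>\<lparr>arrs := (arrs \<sigma>)(x := (arrs \<sigma> x)(aval \<sigma> a1 := aval \<sigma> a2))\<rparr>)
        (lval I vN vL e)"
      by (rule ag_e) (simp add: i ArrAssign step_arr_assign)
    with ag decl ArrAssign show ?thesis by (simp add: sat_update_arr)
  next
    case (Ite l b c1 c2)
    then have ks: "ks = map vN ws" by (simp add: ks_def)
    have cond: "sat I vN vI vL (bexp_at (start ws s) b) \<longleftrightarrow> bval \<sigma> b"
      using sat_bexp_at[OF ag] decl Ite by simp
    have "agrees p I \<sigma> (lval I vN vL (start_ctx ws c))"
      if "step (r i) (enter ks c @ K, \<sigma>)" for c
      using agrees_run[OF run_step[OF run that]] lval_start_ctx ks by metis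
    then have "bval \<sigma> b \<Longrightarrow> agrees p I \<sigma> (lval I vN vL (start_ctx ws c1))"
      "\<not> bval \<sigma> b \<Longrightarrow> agrees p I \<sigma> (lval I vN vL (start_ctx ws c2))"
      using i Ite step_ite_true step_ite_false by metis+
    with cond ag show ?thesis
      unfolding Ite by (auto simp: Let_def intro: sat_eq_all)
  next
    case (While l b c)
    have "label_of s \<notin> set ws"
      using label_not_enclosing(2)[of "main p" "[]"] wf occ
      by (auto simp: wf_program_def occs_def)
    then show ?thesis
      using sat_sem_while occ tp decl While ks_def by simp
  qed
qed

lemma models_ax_sem: "models I (ax_sem p)"
  unfolding models_def ax_sem_def
  by (auto intro!: sat_foldr_FAllN sat_sem_stmt)

end

theorem theorem1:
  fixes p :: program and I :: "'l interp"
  assumes "wf_program p" and "execution_interp p I"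
  shows "models I (ax_sem p)"
proof -
  obtain r where "run p r" "interp_reach p r I" "interp_vars p r I" "interp_last r I"
    using assms(2) by (auto simp: execution_interp_def)
  with assms(1) interpret execution p r I
    by unfold_locales
  show ?thesis by (rule models_ax_sem)
qed

end
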